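(* Let $(A,\mu,\alpha)$ be a Hom-alternative algebra over $\mathbf{k}$. Then the $n$th derived Hom-algebra $A^n=(A,\mu^{(n)}=\alpha^{2^n-1}\circ\mu,\alpha^{2^n})$ is also a Hom-alternative algebra for each $n\ge 0$.
   Context: $\mathbf{k}$ is a fixed field of characteristic $0$; all modules, linear maps and tensor products are over $\mathbf{k}$. A Hom-algebra is a triple $(A,\mu,\alpha)$ with $A$ a $\mathbf{k}$-module, $\mu\colon A\otimes A\to A$ bilinear (not necessarily associative or unital), and $\alpha\colon A\to A$ linear with $\alpha(\mu(x,y))=\mu(\alpha(x),\alpha(y))$ for all $x,y$. The Hom-associator is $as_A(x,y,z)=\mu(\mu(x,y),\alpha(z))-\mu(\alpha(x),\mu(y,z))$. $A$ is Hom-alternative if $as_A$ is alternating (changes by the sign of the permutation when its arguments are permuted). Powers $\alpha^k$ denote $k$-fold composition, $\alpha^0=\mathrm{Id}$. *)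

theory Defs
  imports Complex_Main "HOL-Combinatorics.Permutations"
begin

text \<open>The underlying vector space of a Hom-algebra is a whole type with an explicit scalar
  multiplication \<open>scale\<close>; the multiplication, a linear map out of a tensor square, is given
  as a curried bilinear map.\<close>

locale hom_algebra = vector_space scale
  for scale :: "'k::field_char_0 \<Rightarrow> 'a::ab_group_add \<Rightarrow> 'a" +
  fixes \<mu> :: "'a \<Rightarrow> 'a \<Rightarrow> 'a"
    and \<alpha> :: "'a \<Rightarrow> 'a"
  assumes linear_mult_right: "\<And>x. Vector_Spaces.linear scale scale (\<lambda>y. \<mu> x y)"
    and linear_mult_left: "\<And>y. Vector_Spaces.linear scale scale (\<lambda>x. \<mu> x y)"
    and linear_twist: "Vector_Spaces.linear scale scale \<alpha>"
    and twist_mult: "\<And>x y. \<alpha> (\<mu> x y) = \<mu> (\<alpha> x) (\<alpha> y)"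

definition hom_associator ::
    "('a::ab_group_add \<Rightarrow> 'a \<Rightarrow> 'a) \<Rightarrow> ('a \<Rightarrow> 'a) \<Rightarrow> 'a \<Rightarrow> 'a \<Rightarrow> 'a \<Rightarrow> 'a"
  where "hom_associator \<mu> \<alpha> x y z =
    \<mu> (\<mu> x y) (\<alpha> z) - \<mu> (\<alpha> x) (\<mu> y z)"

text \<open>The three arguments are read as a family \<open>x\<close> indexed by \<open>{..<3}\<close>;
  its values elsewhere play no role.\<close>

definition alternating3 ::
    "('k::field_char_0 \<Rightarrow> 'a::ab_group_add \<Rightarrow> 'a) \<Rightarrow> ('a \<Rightarrow> 'a \<Rightarrow> 'a \<Rightarrow> 'a) \<Rightarrow> bool"
  where "alternating3 scale f \<longleftrightarrow>
    (\<forall>p x. p permutes {..<3::nat} \<longrightarrow>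
      f (x (p 0)) (x (p 1)) (x (p 2)) = scale (of_int (sign p)) (f (x 0) (x 1) (x 2)))"

locale hom_alternative_algebra = hom_algebra scale \<mu> \<alpha>
  for scale :: "'k::field_char_0 \<Rightarrow> 'a::ab_group_add \<Rightarrow> 'a"
    and \<mu> :: "'a \<Rightarrow> 'a \<Rightarrow> 'a"
    and \<alpha> :: "'a \<Rightarrow> 'a" +
  assumes alternating_associator: "alternating3 scale (hom_associator \<mu> \<alpha>)"

definition derived_mult ::
    "nat \<Rightarrow> ('a \<Rightarrow> 'a \<Rightarrow> 'a) \<Rightarrow> ('a \<Rightarrow> 'a) \<Rightarrow> 'a \<Rightarrow> 'a \<Rightarrow> 'a"
  where "derived_mult n \<mu> \<alpha> x y = (\<alpha> ^^ (2 ^ n - 1)) (\<mu> x y)"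

definition derived_twist :: "nat \<Rightarrow> ('a \<Rightarrow> 'a) \<Rightarrow> 'a \<Rightarrow> 'a"
  where "derived_twist n \<alpha> = \<alpha> ^^ (2 ^ n)"

end

theory Submission
  imports Defs
begin

text \<open>Put \<open>m = 2 ^ n - 1\<close>, so that the derived algebra has multiplication \<open>\<alpha>\<^sup>m \<circ> \<mu>\<close> and twist
  \<open>\<alpha>\<^sup>m\<^sup>+\<^sup>1\<close>. Multiplicativity of \<open>\<alpha>\<close> lets every power of \<open>\<alpha>\<close> in the new Hom-associator be pulled
  to the outside, and both of its terms collect the same power: the new Hom-associator is
  \<open>\<alpha>\<^sup>2\<^sup>m \<circ> as\<close>. A linear map applied to an alternating map is alternating. That both terms
  collect the same power depends only on the twist exponent exceeding the multiplication
  exponent by one, so the lemmas below are about an arbitrary \<open>m\<close>.\<close>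

context hom_algebra
begin

lemma linear_twist_power: "Vector_Spaces.linear scale scale (\<alpha> ^^ m)"
proof (induction m)
  case 0
  show ?case unfolding funpow.simps by (rule linear_id)
next
  case (Suc m)
  then show ?case
    unfolding funpow.simps by (rule Vector_Spaces.linear_compose[OF _ linear_twist])
qed

lemma twist_power_mult: "(\<alpha> ^^ m) (\<mu> x y) = \<mu> ((\<alpha> ^^ m) x) ((\<alpha> ^^ m) y)"
  by (induction m) (simp_all add: twist_mult)

lemma hom_algebra_twist_power:
  "hom_algebra scale (\<lambda>x y. (\<alpha> ^^ m) (\<mu> x y)) (\<alpha> ^^ k)"
proof (intro hom_algebra.intro hom_algebra_axioms.intro)
  show "vector_space scale"
    by (rule vector_space_axioms)
  show "Vector_Spaces.linear scale scale (\<lambda>y. (\<alpha> ^^ m) (\<mu> x y))" for x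
    using Vector_Spaces.linear_compose[OF linear_mult_right linear_twist_power]
    by (simp add: comp_def)
  show "Vector_Spaces.linear scale scale (\<lambda>x. (\<alpha> ^^ m) (\<mu> x y))" for y
    using Vector_Spaces.linear_compose[OF linear_mult_left linear_twist_power]
    by (simp add: comp_def)
  show "Vector_Spaces.linear scale scale (\<alpha> ^^ k)"
    by (rule linear_twist_power)
  have commute: "(\<alpha> ^^ k) ((\<alpha> ^^ m) u) = (\<alpha> ^^ m) ((\<alpha> ^^ k) u)" for u
    by (metis add.commute comp_apply funpow_add)
  show "(\<alpha> ^^ k) ((\<alpha> ^^ m) (\<mu> x y)) = (\<alpha> ^^ m) (\<mu> ((\<alpha> ^^ k) x) ((\<alpha> ^^ k) y))" for x y
    by (simp only: commute twist_power_mult[of k])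
qed

text \<open>In the first term the inner product contributes \<open>\<alpha>\<^sup>m\<close> and the twisted argument
  \<open>\<alpha>\<^sup>m\<^sup>+\<^sup>1\<close>; factoring out \<open>\<alpha>\<^sup>m\<close> leaves exactly the one \<open>\<alpha>\<close> of the old associator, and
  the outer product supplies the second factor \<open>\<alpha>\<^sup>m\<close>. The other term is symmetric.\<close>

lemma hom_associator_twist_power:
  "hom_associator (\<lambda>x y. (\<alpha> ^^ m) (\<mu> x y)) (\<alpha> ^^ Suc m) x y z
    = (\<alpha> ^^ (m + m)) (hom_associator \<mu> \<alpha> x y z)"
proof -
  have twist_Suc: "(\<alpha> ^^ Suc m) u = (\<alpha> ^^ m) (\<alpha> u)" for u
    by (simp add: funpow_swap1)
  have "hom_associator (\<lambda>x y. (\<alpha> ^^ m) (\<mu> x y)) (\<alpha> ^^ Suc m) x y z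
      = (\<alpha> ^^ m) ((\<alpha> ^^ m) (\<mu> (\<mu> x y) (\<alpha> z))) - (\<alpha> ^^ m) ((\<alpha> ^^ m) (\<mu> (\<alpha> x) (\<mu> y z)))"
    by (simp only: hom_associator_def twist_Suc twist_power_mult)
  also have "\<dots> = (\<alpha> ^^ (m + m)) (\<mu> (\<mu> x y) (\<alpha> z)) - (\<alpha> ^^ (m + m)) (\<mu> (\<alpha> x) (\<mu> y z))"
    by (simp add: funpow_add)
  also have "\<dots> = (\<alpha> ^^ (m + m)) (hom_associator \<mu> \<alpha> x y z)"
    unfolding hom_associator_def
    by (rule module_hom.diff[symmetric]) (rule linear_twist_power[THEN Vector_Spaces.linear.axioms(3)])
  finally show ?thesis .
qed

end

lemma alternating3_linear_image:
  assumes "alternating3 scale f" and "Vector_Spaces.linear scale scale g"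
  shows "alternating3 scale (\<lambda>x y z. g (f x y z))"
proof -
  interpret g: Vector_Spaces.linear scale scale g by (rule assms(2))
  show ?thesis
    using assms(1) unfolding alternating3_def by (simp add: g.scale)
qed

lemma (in hom_alternative_algebra) hom_alternative_algebra_twist_power:
  "hom_alternative_algebra scale (\<lambda>x y. (\<alpha> ^^ m) (\<mu> x y)) (\<alpha> ^^ Suc m)"
proof (intro hom_alternative_algebra.intro hom_alternative_algebra_axioms.intro)
  show "hom_algebra scale (\<lambda>x y. (\<alpha> ^^ m) (\<mu> x y)) (\<alpha> ^^ Suc m)"
    by (rule hom_algebra_twist_power)
  have "hom_associator (\<lambda>x y. (\<alpha> ^^ m) (\<mu> x y)) (\<alpha> ^^ Suc m)
      = (\<lambda>x y z. (\<alpha> ^^ (m + m)) (hom_associator \<mu> \<alpha> x y z))"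
    by (intro ext) (rule hom_associator_twist_power)
  then show "alternating3 scale (hom_associator (\<lambda>x y. (\<alpha> ^^ m) (\<mu> x y)) (\<alpha> ^^ Suc m))"
    by (simp only: alternating3_linear_image[OF alternating_associator linear_twist_power])
qed

theorem proposition6p2:
  fixes scale :: "'k::field_char_0 \<Rightarrow> 'a::ab_group_add \<Rightarrow> 'a"
    and \<mu> :: "'a \<Rightarrow> 'a \<Rightarrow> 'a"
    and \<alpha> :: "'a \<Rightarrow> 'a"
    and n :: nat
  assumes "hom_alternative_algebra scale \<mu> \<alpha>"
  shows "hom_alternative_algebra scale (derived_mult n \<mu> \<alpha>) (derived_twist n \<alpha>)"
proof -
  have mult: "derived_mult n \<mu> \<alpha> = (\<lambda>x y. (\<alpha> ^^ (2 ^ n - 1)) (\<mu> x y))"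
    by (intro ext) (rule derived_mult_def)
  have "Suc (2 ^ n - 1) = (2 ^ n :: nat)"
    by simp
  then have twist: "derived_twist n \<alpha> = \<alpha> ^^ Suc (2 ^ n - 1)"
    unfolding derived_twist_def by (simp only:)
  show ?thesis
    unfolding mult twist
    using assms by (rule hom_alternative_algebra.hom_alternative_algebra_twist_power)
qed

end
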